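(* There is no deterministic online algorithm for the continuous setting of the restricted data-center model that achieves a competitive ratio $c<2$.
   Context: Restricted model: given $m\in\mathbb{N}$, $\beta>0$, a non-negative convex function $f:[0,1]\to\mathbb{R}_{\ge0}$ (known in advance) and loads $\lambda_1,\dots,\lambda_T\ge0$, find $X=(x_1,\dots,x_T)$ with $x_t\in[0,m]$ real (continuous setting) and $x_t\ge\lambda_t$ minimizing $\sum_{t=1}^T x_tf(\lambda_t/x_t)+\beta\sum_{t=1}^T(x_t-x_{t-1})^+$ with $x_0=0$ and $(y)^+=\max(0,y)$. Online: $\lambda_t$ is revealed at time $t$ and $x_t$ must be chosen then, irrevocably. An online algorithm has competitive ratio $c$ if on every instance its cost is at most $c$ times the optimal offline cost. *)

theory Defs
  imports "HOL-Analysis.Analysis"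
begin

(* The operating cost f is represented by a function on all reals; only its values on [0,1]
   are constrained, and only those values enter the costs of feasible schedules. *)
definition restricted_model :: "nat \<Rightarrow> real \<Rightarrow> (real \<Rightarrow> real) \<Rightarrow> bool" where
  "restricted_model m \<beta> f \<longleftrightarrow>
     m \<ge> 1 \<and> \<beta> > 0 \<and> convex_on {0..1} f \<and> (\<forall>z\<in>{0..1}. f z \<ge> 0)"

(* The load sequence lambda_1, ..., lambda_T is a list, so T is its length. The bound by m
   says exactly that some schedule is feasible. *)
definition load_sequence :: "nat \<Rightarrow> real list \<Rightarrow> bool" where
  "load_sequence m ls \<longleftrightarrow> (\<forall>l\<in>set ls. 0 \<le> l \<and> l \<le> real m)"

definition feasible :: "nat \<Rightarrow> real list \<Rightarrow> real list \<Rightarrow> bool" where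
  "feasible m ls xs \<longleftrightarrow> length xs = length ls \<and>
     (\<forall>t<length ls. 0 \<le> xs ! t \<and> xs ! t \<le> real m \<and> ls ! t \<le> xs ! t)"

(* List positions start at 0, so xs ! t is x_(t+1), and x_0 = 0 is the case t = 0 below.
   If x = 0 (hence l = 0), the operating cost x * f (l / x) is 0. *)
definition cost :: "real \<Rightarrow> (real \<Rightarrow> real) \<Rightarrow> real list \<Rightarrow> real list \<Rightarrow> real" where
  "cost \<beta> f ls xs =
     (\<Sum>t<length ls. xs ! t * f (ls ! t / xs ! t)) +
     \<beta> * (\<Sum>t<length ls. max 0 (xs ! t - (if t = 0 then 0 else xs ! (t - 1))))"

(* An infimum, since f need not be continuous at the end points of [0,1]
   and the minimum may then fail to be attained. *)
definition offline_opt :: "nat \<Rightarrow> real \<Rightarrow> (real \<Rightarrow> real) \<Rightarrow> real list \<Rightarrow> real" where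
  "offline_opt m \<beta> f ls = (INF xs\<in>{xs. feasible m ls xs}. cost \<beta> f ls xs)"

(* A m beta f [lambda_1, ..., lambda_t] is the state x_t. The parameters m, beta, f are known in
   advance; neither future loads nor T are. Earlier decisions of a deterministic algorithm
   are determined by the loads seen so far, so they need not be passed as arguments. *)
type_synonym online_alg = "nat \<Rightarrow> real \<Rightarrow> (real \<Rightarrow> real) \<Rightarrow> real list \<Rightarrow> real"

definition schedule ::
  "online_alg \<Rightarrow> nat \<Rightarrow> real \<Rightarrow> (real \<Rightarrow> real) \<Rightarrow> real list \<Rightarrow> real list" where
  "schedule A m \<beta> f ls = map (\<lambda>t. A m \<beta> f (take (Suc t) ls)) [0..<length ls]"

definition online_algorithm :: "online_alg \<Rightarrow> bool" where
  "online_algorithm A \<longleftrightarrow>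
     (\<forall>m \<beta> f ls. restricted_model m \<beta> f \<longrightarrow> load_sequence m ls \<longrightarrow>
        feasible m ls (schedule A m \<beta> f ls))"

definition competitive_ratio :: "online_alg \<Rightarrow> real \<Rightarrow> bool" where
  "competitive_ratio A c \<longleftrightarrow>
     (\<forall>m \<beta> f ls. restricted_model m \<beta> f \<longrightarrow> load_sequence m ls \<longrightarrow>
        cost \<beta> f ls (schedule A m \<beta> f ls) \<le> c * offline_opt m \<beta> f ls)"

end

theory Submission
  imports Defs
begin

text \<open>
  Take \<open>m = 1\<close>, \<open>\<beta> = 2\<close> and \<open>f z = \<epsilon> * \<bar>1 - z / s\<bar>\<close> with small \<open>s\<close>. Load \<open>0\<close> then has
  operating cost \<open>\<epsilon> x\<close> and load \<open>s\<close> has operating cost \<open>\<epsilon> (1 - x)\<close>, while the constraint \<open>x \<ge> s\<close>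
  is negligible. For the offline player it is enough to use the states \<open>s\<close> and \<open>1\<close>; let \<open>w\<close> and
  \<open>w + 2 (1 - u)\<close> bound the costs of ending there. A load \<open>s\<close> raises \<open>u\<close> by \<open>\<epsilon> / 2\<close>
  and a load \<open>0\<close> lowers it by \<open>\<epsilon> / 2\<close>, and \<open>u\<close> is clamped to \<open>[0, 1]\<close>. The adversary sends
  \<open>s\<close> if the online state \<open>x\<close> is below about \<open>u\<close>, and \<open>0\<close> otherwise. With a bounded
  potential in \<open>x\<close> and \<open>u\<close>, each step costs the algorithm almost twice the increase of the mean
  \<open>w + 1 - u\<close> of the two bounds, and clamped steps cost only the algorithm. So for \<open>c < 2\<close> the online
  cost exceeds \<open>c\<close> times the offline cost by an amount that grows linearly in the number of steps.
\<close>

section \<open>Appending a step to a schedule\<close>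

definition final_state :: "real list \<Rightarrow> real" where
  "final_state xs = (if xs = [] then 0 else last xs)"

lemma final_state_Nil [simp]: "final_state [] = 0"
  and final_state_snoc [simp]: "final_state (xs @ [x]) = x"
  by (simp_all add: final_state_def)

lemma cost_Nil [simp]: "cost \<beta> f [] xs = 0"
  by (simp add: cost_def)

lemma cost_snoc:
  assumes len: "length xs = length ls"
  shows "cost \<beta> f (ls @ [l]) (xs @ [x]) =
    cost \<beta> f ls xs + x * f (l / x) + \<beta> * max 0 (x - final_state xs)"
proof -
  have op: "(\<Sum>t<length ls. (xs @ [x]) ! t * f ((ls @ [l]) ! t / (xs @ [x]) ! t)) =
      (\<Sum>t<length ls. xs ! t * f (ls ! t / xs ! t))"
    using len by (intro sum.cong) (auto simp: nth_append)
  have sw: "(\<Sum>t<length ls. max 0 ((xs @ [x]) ! t - (if t = 0 then 0 else (xs @ [x]) ! (t - 1)))) =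
      (\<Sum>t<length ls. max 0 (xs ! t - (if t = 0 then 0 else xs ! (t - 1))))"
    using len by (intro sum.cong) (auto simp: nth_append)
  have prev: "(if length ls = 0 then 0 else (xs @ [x]) ! (length ls - 1)) = final_state xs"
    using len by (auto simp: final_state_def nth_append last_conv_nth)
  have new: "(xs @ [x]) ! length ls = x" "(ls @ [l]) ! length ls = l"
    using len by (auto simp: nth_append)
  show ?thesis
    unfolding cost_def length_append_singleton sum.lessThan_Suc op sw prev new
    by (simp add: algebra_simps)
qed

lemma feasible_snoc:
  assumes "feasible m ls xs" "0 \<le> x" "x \<le> real m" "l \<le> x"
  shows "feasible m (ls @ [l]) (xs @ [x])"
  using assms by (auto simp: feasible_def nth_append less_Suc_eq)

lemma schedule_snoc:
  "schedule A m \<beta> f (ls @ [l]) = schedule A m \<beta> f ls @ [A m \<beta> f (ls @ [l])]"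
  by (simp add: schedule_def)

lemma length_schedule [simp]: "length (schedule A m \<beta> f ls) = length ls"
  by (simp add: schedule_def)

lemma load_sequence_snoc [simp]:
  "load_sequence m (ls @ [l]) \<longleftrightarrow> load_sequence m ls \<and> 0 \<le> l \<and> l \<le> real m"
  by (auto simp: load_sequence_def)

lemma online_step_feasible:
  assumes alg: "online_algorithm A" and model: "restricted_model m \<beta> f"
    and loads: "load_sequence m (ls @ [l])"
  defines "x \<equiv> A m \<beta> f (ls @ [l])"
  shows "0 \<le> x" "x \<le> real m" "l \<le> x"
proof -
  have feas: "feasible m (ls @ [l]) (schedule A m \<beta> f (ls @ [l]))"
    using alg model loads unfolding online_algorithm_def by blast
  have "schedule A m \<beta> f (ls @ [l]) ! length ls = x"
    unfolding schedule_snoc x_def by (simp add: nth_append)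
  with feas show "0 \<le> x" "x \<le> real m" "l \<le> x"
    unfolding feasible_def by (metis length_append_singleton lessI nth_append_length)+
qed

lemma final_state_schedule_bounds:
  assumes "online_algorithm A" "restricted_model m \<beta> f" "load_sequence m ls"
  shows "0 \<le> final_state (schedule A m \<beta> f ls)" "final_state (schedule A m \<beta> f ls) \<le> real m"
  using assms online_step_feasible(1,2)[of A m \<beta> f]
  by (cases ls rule: rev_cases; simp add: schedule_snoc; simp add: schedule_def)+

section \<open>Bounding the offline optimum\<close>

lemma cost_nonneg:
  assumes model: "restricted_model m \<beta> f" and loads: "load_sequence m ls"
    and feas: "feasible m ls xs"
  shows "0 \<le> cost \<beta> f ls xs"
proof -
  have "0 \<le> xs ! t * f (ls ! t / xs ! t)" if t: "t < length ls" for t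
  proof (rule mult_nonneg_nonneg)
    show "0 \<le> xs ! t" using feas t by (auto simp: feasible_def)
    have "0 \<le> ls ! t" "ls ! t \<le> xs ! t"
      using feas loads t by (auto simp: feasible_def load_sequence_def)
    then have "ls ! t / xs ! t \<in> {0..1}" by (auto simp: divide_le_eq_1)
    then show "0 \<le> f (ls ! t / xs ! t)"
      using model by (auto simp: restricted_model_def)
  qed
  moreover have "0 \<le> \<beta>" using model by (simp add: restricted_model_def)
  ultimately show ?thesis
    unfolding cost_def by (intro add_nonneg_nonneg mult_nonneg_nonneg[of \<beta>] sum_nonneg) auto
qed

lemma offline_opt_le:
  assumes "restricted_model m \<beta> f" "load_sequence m ls" "feasible m ls xs"
  shows "offline_opt m \<beta> f ls \<le> cost \<beta> f ls xs"
  unfolding offline_opt_def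
  using assms cost_nonneg[OF assms(1,2)] by (intro cINF_lower bdd_belowI2[where m = 0]) auto

lemma offline_opt_nonneg:
  assumes model: "restricted_model m \<beta> f" and loads: "load_sequence m ls"
  shows "0 \<le> offline_opt m \<beta> f ls"
proof -
  \<comment> \<open>The loads themselves serve as a schedule, so the infimum ranges over a nonempty
    set.\<close>
  have "feasible m ls ls"
    using loads by (auto simp: feasible_def load_sequence_def)
  then show ?thesis
    unfolding offline_opt_def using cost_nonneg[OF model loads] by (intro cINF_greatest) auto
qed

text \<open>The move to \<open>y\<close> is paid in advance, so that the next state \<open>y\<close> causes no switching cost.\<close>

definition reachable :: "nat \<Rightarrow> real \<Rightarrow> (real \<Rightarrow> real) \<Rightarrow> real \<Rightarrow> real list \<Rightarrow> real \<Rightarrow> bool" where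
  "reachable m \<beta> f y ls w \<longleftrightarrow>
     (\<exists>xs. feasible m ls xs \<and> cost \<beta> f ls xs + \<beta> * max 0 (y - final_state xs) \<le> w)"

lemma reachable_Nil: "\<beta> * max 0 y \<le> w \<Longrightarrow> reachable m \<beta> f y [] w"
  by (auto simp: reachable_def feasible_def)

lemma reachable_snoc:
  assumes "reachable m \<beta> f y ls w" "0 \<le> y" "y \<le> real m" "l \<le> y"
  shows "reachable m \<beta> f y (ls @ [l]) (w + y * f (l / y))"
proof -
  obtain xs where xs: "feasible m ls xs" "cost \<beta> f ls xs + \<beta> * max 0 (y - final_state xs) \<le> w"
    using assms(1) by (auto simp: reachable_def)
  then have "length xs = length ls" by (simp add: feasible_def)
  with xs assms show ?thesis
    unfolding reachable_def by (intro exI[of _ "xs @ [y]"]) (simp add: feasible_snoc cost_snoc)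
qed

lemma reachable_move:
  assumes "reachable m \<beta> f y ls v" "0 \<le> \<beta>" "v + \<beta> * max 0 (z - y) \<le> w"
  shows "reachable m \<beta> f z ls w"
proof -
  obtain xs where xs: "feasible m ls xs" "cost \<beta> f ls xs + \<beta> * max 0 (y - final_state xs) \<le> v"
    using assms(1) by (auto simp: reachable_def)
  \<comment> \<open>Going via \<open>y\<close> never needs less switching up than going straight to
    \<open>z\<close>.\<close>
  have "\<beta> * max 0 (z - final_state xs) \<le> \<beta> * (max 0 (y - final_state xs) + max 0 (z - y))"
    using assms(2) by (intro mult_left_mono) auto
  with xs assms(3) show ?thesis
    unfolding reachable_def by (intro exI[of _ xs]) (auto simp: distrib_left)
qed

lemma reachable_mono:
  "reachable m \<beta> f y ls v \<Longrightarrow> v \<le> w \<Longrightarrow> reachable m \<beta> f y ls w"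
  by (force simp: reachable_def)

lemma offline_opt_le_reachable:
  assumes "restricted_model m \<beta> f" "load_sequence m ls" "reachable m \<beta> f y ls w"
  shows "offline_opt m \<beta> f ls \<le> w"
proof -
  obtain xs where xs: "feasible m ls xs" "cost \<beta> f ls xs + \<beta> * max 0 (y - final_state xs) \<le> w"
    using assms(3) by (auto simp: reachable_def)
  have "0 \<le> \<beta> * max 0 (y - final_state xs)"
    using assms(1) by (auto simp: restricted_model_def)
  with xs offline_opt_le[OF assms(1,2) xs(1)] show ?thesis by linarith
qed

section \<open>The potential\<close>

text \<open>By the kink, raising \<open>u\<close> by \<open>\<epsilon> / 2\<close> changes the potential by \<open>- \<epsilon> x\<close> where \<open>x < u\<close>, and
  lowering it changes the potential by \<open>- \<epsilon> (1 - x)\<close> where \<open>x > u\<close>. In both cases the operating cost of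
  \<open>x\<close> is \<open>\<epsilon>\<close> plus that change. The term \<open>x\<^sup>2\<close> puts the \<open>x\<close>-slope into \<open>[\<epsilon>, 2 + \<epsilon>]\<close>, and \<open>\<epsilon> x\<close>
  pays for the difference between the operating costs of the old and the new state.\<close>

definition potential :: "real \<Rightarrow> real \<Rightarrow> real \<Rightarrow> real" where
  "potential \<epsilon> x u = x\<^sup>2 - 2 * u * x - 2 * max 0 (u - x) + \<epsilon> * x + 2 * u"

lemma potential_ge:
  assumes "0 \<le> \<epsilon>" "0 \<le> x" "x \<le> 1" "0 \<le> u" "u \<le> 1"
  shows "- 4 \<le> potential \<epsilon> x u"
proof -
  have "2 * u * x \<le> 2 * u" using assms by (simp add: mult_left_le)
  moreover have "0 \<le> \<epsilon> * x" "0 \<le> x\<^sup>2" using assms by auto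
  moreover have "max 0 (u - x) \<le> 1" using assms by auto
  ultimately show ?thesis unfolding potential_def by (smt (verit, best))
qed

lemma potential_increment:
  assumes "x \<le> y" "0 \<le> x" "y \<le> 1" "0 \<le> u" "u \<le> 1"
  shows "\<epsilon> * (y - x) \<le> potential \<epsilon> y u - potential \<epsilon> x u"
    and "potential \<epsilon> y u - potential \<epsilon> x u \<le> (2 + \<epsilon>) * (y - x)"
proof -
  \<comment> \<open>Secant slopes on either side of the kink at \<open>u\<close>. For states in
    [0, 1] both slopes lie between \<epsilon> and 2 + \<epsilon>.\<close>
  have below: "potential \<epsilon> b u - potential \<epsilon> a u = (b - a) * (\<epsilon> + (a + b + 2 - 2 * u))"
    if "a \<le> u" "b \<le> u" for a b
    using that by (simp add: potential_def max_def algebra_simps power2_eq_square)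
  have above: "potential \<epsilon> b u - potential \<epsilon> a u = (b - a) * (\<epsilon> + (a + b - 2 * u))"
    if "u \<le> a" "u \<le> b" for a b
    using that by (simp add: potential_def max_def algebra_simps power2_eq_square)
  have lo: "\<epsilon> * (b - a) \<le> (b - a) * (\<epsilon> + r)" and hi: "(b - a) * (\<epsilon> + r) \<le> (2 + \<epsilon>) * (b - a)"
    if "a \<le> b" "0 \<le> r" "r \<le> 2" for a b r :: real
  proof -
    have "0 \<le> (b - a) * r" "0 \<le> (b - a) * (2 - r)" using that by auto
    then show "\<epsilon> * (b - a) \<le> (b - a) * (\<epsilon> + r)" "(b - a) * (\<epsilon> + r) \<le> (2 + \<epsilon>) * (b - a)"
      by (auto simp: algebra_simps)
  qed
  consider "y \<le> u" | "u \<le> x" | "x \<le> u" "u \<le> y" by linarith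
  then have "\<epsilon> * (y - x) \<le> potential \<epsilon> y u - potential \<epsilon> x u \<and>
    potential \<epsilon> y u - potential \<epsilon> x u \<le> (2 + \<epsilon>) * (y - x)"
  proof cases
    case 1
    then show ?thesis using assms lo hi by (subst (1 2) below) auto
  next
    case 2
    then show ?thesis using assms lo hi by (subst (1 2) above) auto
  next
    case 3
    have "\<epsilon> * (u - x) \<le> potential \<epsilon> u u - potential \<epsilon> x u"
      "potential \<epsilon> u u - potential \<epsilon> x u \<le> (2 + \<epsilon>) * (u - x)"
      using assms 3 below[of x u] lo[of x u "x + u + 2 - 2 * u"] hi[of x u "x + u + 2 - 2 * u"]
      by auto
    moreover have "\<epsilon> * (y - u) \<le> potential \<epsilon> y u - potential \<epsilon> u u"
      "potential \<epsilon> y u - potential \<epsilon> u u \<le> (2 + \<epsilon>) * (y - u)"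
      using assms 3 above[of u y] lo[of u y "u + y - 2 * u"] hi[of u y "u + y - 2 * u"]
      by auto
    ultimately show ?thesis by (auto simp: algebra_simps)
  qed
  then show "\<epsilon> * (y - x) \<le> potential \<epsilon> y u - potential \<epsilon> x u"
    "potential \<epsilon> y u - potential \<epsilon> x u \<le> (2 + \<epsilon>) * (y - x)" by auto
qed

text \<open>The case x \<le> y dictates the factor 1 + \<epsilon>: the potential rises by up to (2 +
  \<epsilon>)(y - x), and \<epsilon> (1 - x) exceeds \<epsilon> (1 - y) by another \<epsilon> (y -
  x).\<close>

lemma online_cost_up:
  assumes "0 \<le> \<epsilon>" "0 \<le> x" "x \<le> 1" "0 \<le> y" "y \<le> 1" "0 \<le> u" "u \<le> 1"
  shows "\<epsilon> * (1 - x) + (potential \<epsilon> y u - potential \<epsilon> x u) \<le>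
    (1 + \<epsilon>) * (\<epsilon> * (1 - y) + 2 * max 0 (y - x))"
proof -
  have "0 \<le> \<epsilon> * (\<epsilon> * (1 - y))" using assms by simp
  moreover have "\<epsilon> * y \<le> \<epsilon> * x" if "y \<le> x" using that assms by (simp add: mult_left_mono)
  moreover have "\<epsilon> * x \<le> \<epsilon> * y" if "x \<le> y" using that assms by (simp add: mult_left_mono)
  ultimately show ?thesis
    using potential_increment[of x y u \<epsilon>] potential_increment[of y x u \<epsilon>] assms
    by (cases "x \<le> y") (auto simp: max_def algebra_simps)
qed

lemma online_cost_down:
  assumes "0 \<le> \<epsilon>" "0 \<le> x" "x \<le> 1" "0 \<le> y" "y \<le> 1" "0 \<le> u" "u \<le> 1"
  shows "\<epsilon> * x + (potential \<epsilon> y u - potential \<epsilon> x u) \<le>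
    (1 + \<epsilon>) * (\<epsilon> * y + 2 * max 0 (y - x))"
proof -
  have "\<epsilon> * x + (potential \<epsilon> y u - potential \<epsilon> x u) \<le> \<epsilon> * y + 2 * max 0 (y - x)"
    using potential_increment[of x y u \<epsilon>] potential_increment[of y x u \<epsilon>] assms
    by (cases "x \<le> y") (auto simp: max_def algebra_simps)
  also have "\<dots> \<le> (1 + \<epsilon>) * (\<epsilon> * y + 2 * max 0 (y - x))"
    using assms by (simp add: distrib_right)
  finally show ?thesis .
qed

text \<open>If x \<le> u, the terms containing \<open>u\<close> change by -\<epsilon> x, -\<epsilon>
  and \<epsilon>. An overshoot of at most \<delta> weakens the second by at most 2 \<delta>.\<close>

lemma potential_up:
  assumes "0 \<le> \<epsilon>" "0 \<le> \<delta>" "x \<le> u + \<delta>"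
  shows "potential \<epsilon> x (u + \<epsilon> / 2) - potential \<epsilon> x u \<le> 2 * \<delta> - \<epsilon> * x"
  using assms by (auto simp: potential_def max_def algebra_simps)

lemma potential_down:
  assumes "0 \<le> \<epsilon>" "0 \<le> \<delta>" "u - \<delta> \<le> x"
  shows "potential \<epsilon> x (u - \<epsilon> / 2) - potential \<epsilon> x u \<le> 2 * \<delta> - \<epsilon> * (1 - x)"
  using assms by (auto simp: potential_def max_def algebra_simps)

section \<open>The adversary\<close>

lemma convex_on_abs_affine:
  assumes "0 \<le> \<epsilon>"
  shows "convex_on {0..1} (\<lambda>z. \<epsilon> * \<bar>1 - z / s\<bar> :: real)"
proof (rule convex_onI)
  fix t x y :: real
  assume t: "0 < t" "t < 1"
  have "1 - ((1 - t) * x + t * y) / s = (1 - t) * (1 - x / s) + t * (1 - y / s)"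
    by (simp add: add_divide_distrib diff_divide_distrib algebra_simps)
  then have "\<bar>1 - ((1 - t) * x + t * y) / s\<bar> \<le> (1 - t) * \<bar>1 - x / s\<bar> + t * \<bar>1 - y / s\<bar>"
    using t abs_triangle_ineq[of "(1 - t) * (1 - x / s)" "t * (1 - y / s)"]
    by (simp add: abs_mult)
  then have "\<epsilon> * \<bar>1 - ((1 - t) * x + t * y) / s\<bar> \<le>
      \<epsilon> * ((1 - t) * \<bar>1 - x / s\<bar> + t * \<bar>1 - y / s\<bar>)"
    using assms by (rule mult_left_mono)
  then show "\<epsilon> * \<bar>1 - ((1 - t) *\<^sub>R x + t *\<^sub>R y) / s\<bar> \<le>
      (1 - t) * (\<epsilon> * \<bar>1 - x / s\<bar>) + t * (\<epsilon> * \<bar>1 - y / s\<bar>)"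
    by (simp add: algebra_simps)
qed simp

section \<open>The instance and its parameters\<close>

locale adversary =
  fixes A :: online_alg and n :: nat and c :: real
  assumes alg: "online_algorithm A"
    and n_ge: "2 \<le> n" and c_bounds: "0 \<le> c" "c < 2"
begin

text \<open>With this choice \<epsilon> / 2 = 1 / n, so \<open>u\<close> moves on the grid j / n and
  meets 0 and 1 exactly.\<close>

definition \<epsilon> :: real where "\<epsilon> = 2 / real n"

text \<open>Chosen so that c \<epsilon> / 2 falls short of \<epsilon> by exactly 4 \<delta>.\<close>

definition \<delta> :: real where "\<delta> = (2 - c) * \<epsilon> / 8"

text \<open>Small enough that c times the extra offline cost \<epsilon> s per step is at most
  \<epsilon> \<delta> / 2.\<close>

definition s :: real where "s = \<delta> / 4"

definition f :: "real \<Rightarrow> real" where "f z = \<epsilon> * \<bar>1 - z / s\<bar>"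

lemma eps: "0 < \<epsilon>" "\<epsilon> \<le> 1"
  using n_ge by (auto simp: \<epsilon>_def)

lemma delta: "0 < \<delta>" "\<delta> \<le> 1 / 4"
proof -
  show "0 < \<delta>" using c_bounds eps by (simp add: \<delta>_def)
  have "(2 - c) * \<epsilon> \<le> 2 * 1" using c_bounds eps by (intro mult_mono) auto
  then show "\<delta> \<le> 1 / 4" unfolding \<delta>_def by linarith
qed

lemma s_bounds: "0 < s" "s \<le> 1"
  using delta by (auto simp: s_def)

lemma model: "restricted_model 1 2 f"
  using convex_on_abs_affine[of \<epsilon> s] eps by (auto simp: restricted_model_def f_def[abs_def])

lemma op_cost_zero: "x * f (0 / x) = \<epsilon> * x"
  by (simp add: f_def)

text \<open>As x \<le> 1, the argument s / x is at or right of the kink of \<open>f\<close>, where x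
  f(s / x) is affine in x.\<close>

lemma op_cost_s:
  assumes "s \<le> x" "x \<le> 1"
  shows "x * f (s / x) = \<epsilon> * (1 - x)"
proof -
  have "0 < x" using s_bounds assms by linarith
  then have "\<bar>1 - s / x / s\<bar> = (1 - x) / x"
    using s_bounds assms by (auto simp: field_simps)
  with \<open>0 < x\<close> show ?thesis by (simp add: f_def)
qed

abbreviation online_cost :: "real list \<Rightarrow> real" where
  "online_cost ls \<equiv> cost 2 f ls (schedule A 1 2 f ls)"

abbreviation online_state :: "real list \<Rightarrow> real" where
  "online_state ls \<equiv> final_state (schedule A 1 2 f ls)"

lemma online_state_bounds:
  assumes "load_sequence 1 ls"
  shows "0 \<le> online_state ls" "online_state ls \<le> 1"
  using final_state_schedule_bounds[OF alg model assms] by auto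

lemma online_cost_snoc:
  "online_cost (ls @ [l]) = online_cost ls + online_state (ls @ [l]) * f (l / online_state (ls @ [l]))
    + 2 * max 0 (online_state (ls @ [l]) - online_state ls)"
  by (simp add: schedule_snoc cost_snoc)

text \<open>The bounds \<open>w\<close> and \<open>w + 2 (1 - u)\<close> include an extra \<open>\<epsilon> s\<close> per step, the operating cost
  of state \<open>s\<close> under load \<open>0\<close>.\<close>

definition offline_bounds :: "real list \<Rightarrow> real \<Rightarrow> real \<Rightarrow> bool" where
  "offline_bounds ls w u \<longleftrightarrow> reachable 1 2 f s ls w \<and> reachable 1 2 f 1 ls (w + 2 * (1 - u))"

section \<open>Effect of one load on the offline bounds\<close>

lemma reachable_s_load_s:
  assumes "reachable 1 2 f s ls w" "w + \<epsilon> \<le> v"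
  shows "reachable 1 2 f s (ls @ [s]) v"
proof -
  have "reachable 1 2 f s (ls @ [s]) (w + \<epsilon> * (1 - s))"
    using reachable_snoc[OF assms(1), of s] s_bounds op_cost_s[of s] by simp
  moreover have "w + \<epsilon> * (1 - s) \<le> v"
    using assms(2) s_bounds eps by (simp add: algebra_simps) (smt (verit) mult_pos_pos)
  ultimately show ?thesis by (rule reachable_mono)
qed

lemma reachable_1_load_s:
  assumes "reachable 1 2 f 1 ls w"
  shows "reachable 1 2 f 1 (ls @ [s]) w"
  using reachable_snoc[OF assms, of s] s_bounds op_cost_s[of 1] by simp

lemma reachable_s_load_0:
  assumes "reachable 1 2 f s ls w"
  shows "reachable 1 2 f s (ls @ [0]) (w + \<epsilon> * s)"
  using reachable_snoc[OF assms, of 0] s_bounds op_cost_zero[of s] by (simp add: mult.commute)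

lemma reachable_1_load_0:
  assumes "reachable 1 2 f 1 ls w"
  shows "reachable 1 2 f 1 (ls @ [0]) (w + \<epsilon>)"
  using reachable_snoc[OF assms, of 0] op_cost_zero[of 1] by simp

lemma offline_bounds_up:
  assumes "offline_bounds ls w u"
  shows "offline_bounds (ls @ [s]) (w + \<epsilon> + \<epsilon> * s) (u + \<epsilon> / 2)"
  using assms s_bounds eps reachable_s_load_s[of ls w "w + \<epsilon> + \<epsilon> * s"]
    reachable_mono[OF reachable_1_load_s, of ls "w + 2 * (1 - u)"]
  by (auto simp: offline_bounds_def)

text \<open>At u = 1 both bounds are \<open>w\<close>; ending in \<open>s\<close> is achieved by
  staying at 1 and then moving down for free.\<close>

lemma offline_bounds_up_clamped:
  assumes "offline_bounds ls w 1"
  shows "offline_bounds (ls @ [s]) (w + \<epsilon> * s) 1"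
proof -
  have 1: "reachable 1 2 f 1 (ls @ [s]) w"
    using assms reachable_1_load_s by (auto simp: offline_bounds_def)
  have "reachable 1 2 f s (ls @ [s]) w"
    using s_bounds by (intro reachable_move[OF 1]) auto
  with 1 show ?thesis
    unfolding offline_bounds_def using s_bounds eps by (auto elim!: reachable_mono)
qed

lemma offline_bounds_down:
  assumes "offline_bounds ls w u"
  shows "offline_bounds (ls @ [0]) (w + \<epsilon> * s) (u - \<epsilon> / 2)"
  using assms s_bounds eps reachable_s_load_0
    reachable_mono[OF reachable_1_load_0, of ls "w + 2 * (1 - u)"]
  by (auto simp: offline_bounds_def)

text \<open>At u = 0 the bounds differ by 2, which pays for switching up from \<open>s\<close> to 1
  after the load.\<close>

lemma offline_bounds_down_clamped:
  assumes "offline_bounds ls w 0"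
  shows "offline_bounds (ls @ [0]) (w + \<epsilon> * s) 0"
proof -
  have 1: "reachable 1 2 f s (ls @ [0]) (w + \<epsilon> * s)"
    using assms reachable_s_load_0 by (auto simp: offline_bounds_def)
  have "reachable 1 2 f 1 (ls @ [0]) (w + \<epsilon> * s + 2 * (1 - 0))"
    using s_bounds by (intro reachable_move[OF 1]) auto
  with 1 show ?thesis
    unfolding offline_bounds_def by auto
qed

text \<open>Up to a constant, w - j / n is the mean of the two offline bounds. The surplus
  \<epsilon> \<delta> / 2 is the same in every step, so it accumulates.\<close>

lemma adversary_step:
  assumes loads: "load_sequence 1 ls" and j: "j \<le> n"
    and off: "offline_bounds ls w (real j / real n)"
  obtains l j' w' where "load_sequence 1 (ls @ [l])" "j' \<le> n"
    "offline_bounds (ls @ [l]) w' (real j' / real n)"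
    "c * ((w' - real j' / real n) - (w - real j / real n))
      + (potential \<epsilon> (online_state (ls @ [l])) (real j' / real n)
          - potential \<epsilon> (online_state ls) (real j / real n)) + \<epsilon> * \<delta> / 2
      \<le> (1 + \<epsilon>) * (online_cost (ls @ [l]) - online_cost ls)"
proof -
  define x where "x = online_state ls"
  define u where "u = real j / real n"
  have x: "0 \<le> x" "x \<le> 1" using online_state_bounds[OF loads] by (auto simp: x_def)
  have u: "0 \<le> u" "u \<le> 1" using j n_ge by (auto simp: u_def)
  have du: "0 \<le> \<delta> * u" "\<delta> * u \<le> \<delta>"
    using u delta by (auto simp: mult_left_le)
  have off': "offline_bounds ls w u" using off by (simp add: u_def)
  have ed: "\<epsilon> * \<delta> \<le> \<delta>" using eps delta by simp
  have drift: "c * (\<epsilon> * s) \<le> \<epsilon> * \<delta> / 2"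
  proof -
    have "c * (\<epsilon> * s) \<le> 2 * (\<epsilon> * s)" using c_bounds eps s_bounds by (intro mult_right_mono) auto
    then show ?thesis unfolding s_def by linarith
  qed
  have gain: "c * (\<epsilon> / 2) = \<epsilon> - 4 * \<delta>"
    by (simp add: \<delta>_def field_simps)
  \<comment> \<open>The threshold is within \<open>\<delta>\<close> of \<open>u\<close>, but is \<open>\<delta>\<close> at \<open>u = 0\<close> and \<open>1 - \<delta>\<close> at \<open>u = 1\<close>, so that clamped
    steps have operating cost at least \<open>\<epsilon> \<delta>\<close>.\<close>
  show thesis
  proof (cases "x < u + \<delta> - 2 * (\<delta> * u)")
    case True
    define y where "y = online_state (ls @ [s])"
    have loads': "load_sequence 1 (ls @ [s])" using loads s_bounds by simp
    have y: "0 \<le> y" "s \<le> y" "y \<le> 1"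
      using online_step_feasible[OF alg model loads'] by (auto simp: y_def schedule_snoc)
    have cost: "online_cost (ls @ [s]) - online_cost ls = \<epsilon> * (1 - y) + 2 * max 0 (y - x)"
      using online_cost_snoc[of ls s] op_cost_s[of y] y unfolding x_def y_def by linarith
    show thesis
    proof (cases "j = n")
      case top: True
      then have u1: "u = 1" using n_ge by (simp add: u_def)
      have "\<epsilon> * \<delta> \<le> \<epsilon> * (1 - x)" using True u1 eps by (intro mult_left_mono) auto
      moreover have "\<epsilon> * (1 - x) + (potential \<epsilon> y u - potential \<epsilon> x u) \<le>
          (1 + \<epsilon>) * (\<epsilon> * (1 - y) + 2 * max 0 (y - x))"
        using x y u eps by (intro online_cost_up) auto
      moreover have "c * ((w + \<epsilon> * s - u) - (w - u)) = c * (\<epsilon> * s)" by simp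
      ultimately have "c * ((w + \<epsilon> * s - u) - (w - u)) + (potential \<epsilon> y u - potential \<epsilon> x u)
          + \<epsilon> * \<delta> / 2 \<le> (1 + \<epsilon>) * (\<epsilon> * (1 - y) + 2 * max 0 (y - x))"
        using drift by linarith
      moreover have "offline_bounds (ls @ [s]) (w + \<epsilon> * s) u"
        using off' offline_bounds_up_clamped u1 by simp
      ultimately show thesis
        using that[of s j "w + \<epsilon> * s"] loads' j
        unfolding cost x_def[symmetric] y_def[symmetric] u_def[symmetric] by blast
    next
      case False
      define v where "v = u + \<epsilon> / 2"
      have v: "v = real (Suc j) / real n"
        by (simp add: v_def u_def \<epsilon>_def add_divide_distrib)
      have "v \<le> 1" using False j n_ge by (simp add: v)
      \<comment> \<open>The change of potential is split: \<open>u\<close> moves to \<open>v\<close>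
        at the old state \<open>x\<close>, then \<open>x\<close> moves to \<open>y\<close> at
        \<open>v\<close>.\<close>
      then have "\<epsilon> * (1 - x) + (potential \<epsilon> y v - potential \<epsilon> x v) \<le>
          (1 + \<epsilon>) * (\<epsilon> * (1 - y) + 2 * max 0 (y - x))"
        using x y u eps by (intro online_cost_up) (auto simp: v_def)
      moreover have "potential \<epsilon> x v - potential \<epsilon> x u \<le> 2 * \<delta> - \<epsilon> * x"
        unfolding v_def using True eps delta du by (intro potential_up) linarith+
      moreover have "c * ((w + \<epsilon> + \<epsilon> * s - v) - (w - u)) = c * (\<epsilon> / 2) + c * (\<epsilon> * s)"
        by (simp add: v_def algebra_simps)
      ultimately have "c * ((w + \<epsilon> + \<epsilon> * s - v) - (w - u)) + (potential \<epsilon> y v - potential \<epsilon> x u)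
          + \<epsilon> * \<delta> / 2 \<le> (1 + \<epsilon>) * (\<epsilon> * (1 - y) + 2 * max 0 (y - x))"
        \<comment> \<open>Of the slack 4 \<delta>, the potential takes 2 \<delta>; drift and surplus
          take at most \<epsilon> \<delta> \<le> \<delta>.\<close>
        using drift ed delta unfolding gain right_diff_distrib by linarith
      moreover have "offline_bounds (ls @ [s]) (w + \<epsilon> + \<epsilon> * s) v" "Suc j \<le> n"
        using offline_bounds_up[OF off'] j False by (auto simp: v_def)
      ultimately show thesis
        using that[of s "Suc j" "w + \<epsilon> + \<epsilon> * s"] loads'
        unfolding cost v[symmetric] x_def[symmetric] y_def[symmetric] u_def[symmetric] by blast
    qed
  next
    case False
    define y where "y = online_state (ls @ [0])"
    have loads': "load_sequence 1 (ls @ [0])" using loads by simp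
    have y: "0 \<le> y" "y \<le> 1"
      using online_step_feasible[OF alg model loads'] by (auto simp: y_def schedule_snoc)
    have cost: "online_cost (ls @ [0]) - online_cost ls = \<epsilon> * y + 2 * max 0 (y - x)"
      using online_cost_snoc[of ls 0] op_cost_zero[of y] unfolding x_def y_def by linarith
    show thesis
    proof (cases j)
      case 0
      then have u0: "u = 0" by (simp add: u_def)
      have "\<epsilon> * \<delta> \<le> \<epsilon> * x" using False u0 eps by (intro mult_left_mono) auto
      moreover have "\<epsilon> * x + (potential \<epsilon> y u - potential \<epsilon> x u) \<le>
          (1 + \<epsilon>) * (\<epsilon> * y + 2 * max 0 (y - x))"
        using x y u eps by (intro online_cost_down) auto
      moreover have "c * ((w + \<epsilon> * s - u) - (w - u)) = c * (\<epsilon> * s)" by simp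
      ultimately have "c * ((w + \<epsilon> * s - u) - (w - u)) + (potential \<epsilon> y u - potential \<epsilon> x u)
          + \<epsilon> * \<delta> / 2 \<le> (1 + \<epsilon>) * (\<epsilon> * y + 2 * max 0 (y - x))"
        using drift by linarith
      moreover have "offline_bounds (ls @ [0]) (w + \<epsilon> * s) u"
        using off' offline_bounds_down_clamped u0 by simp
      ultimately show thesis
        using that[of 0 j "w + \<epsilon> * s"] loads' j
        unfolding cost x_def[symmetric] y_def[symmetric] u_def[symmetric] by blast
    next
      case (Suc i)
      define v where "v = u - \<epsilon> / 2"
      have v: "v = real i / real n"
        by (simp add: v_def u_def \<epsilon>_def Suc add_divide_distrib)
      have "0 \<le> v" by (simp add: v)
      then have "\<epsilon> * x + (potential \<epsilon> y v - potential \<epsilon> x v) \<le>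
          (1 + \<epsilon>) * (\<epsilon> * y + 2 * max 0 (y - x))"
        using x y u eps by (intro online_cost_down) (auto simp: v_def)
      moreover have "potential \<epsilon> x v - potential \<epsilon> x u \<le> 2 * \<delta> - \<epsilon> * (1 - x)"
        unfolding v_def using False eps delta du by (intro potential_down) linarith+
      moreover have "c * ((w + \<epsilon> * s - v) - (w - u)) = c * (\<epsilon> / 2) + c * (\<epsilon> * s)"
        by (simp add: v_def algebra_simps)
      ultimately have "c * ((w + \<epsilon> * s - v) - (w - u)) + (potential \<epsilon> y v - potential \<epsilon> x u)
          + \<epsilon> * \<delta> / 2 \<le> (1 + \<epsilon>) * (\<epsilon> * y + 2 * max 0 (y - x))"
        using drift ed delta unfolding gain right_diff_distrib by linarith
      moreover have "offline_bounds (ls @ [0]) (w + \<epsilon> * s) v" "i \<le> n"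
        using offline_bounds_down[OF off'] j Suc by (auto simp: v_def)
      ultimately show thesis
        using that[of 0 i "w + \<epsilon> * s"] loads'
        unfolding cost v[symmetric] x_def[symmetric] y_def[symmetric] u_def[symmetric] by blast
    qed
  qed
qed

section \<open>Accumulating the surplus\<close>

lemma adversary_run:
  "\<exists>ls j w. load_sequence 1 ls \<and> j \<le> n \<and> offline_bounds ls w (real j / real n) \<and>
    c * (w - 2 * s - real j / real n) + potential \<epsilon> (online_state ls) (real j / real n)
      + real T * (\<epsilon> * \<delta> / 2) \<le> (1 + \<epsilon>) * online_cost ls"
proof (induction T)
  case 0
  \<comment> \<open>Switching from 0 to \<open>s\<close> costs 2 s, and to 1 costs 2; hence the
    offset 2 s in the invariant.\<close>
  have "offline_bounds [] (2 * s) (real 0 / real n)"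
    using s_bounds by (auto simp: offline_bounds_def intro!: reachable_Nil)
  then show ?case
    by (intro exI[of _ "[]"] exI[of _ 0] exI[of _ "2 * s"])
      (simp add: load_sequence_def schedule_def potential_def)
next
  case (Suc T)
  then obtain ls j w where run: "load_sequence 1 ls" "j \<le> n" "offline_bounds ls w (real j / real n)"
    "c * (w - 2 * s - real j / real n) + potential \<epsilon> (online_state ls) (real j / real n)
      + real T * (\<epsilon> * \<delta> / 2) \<le> (1 + \<epsilon>) * online_cost ls"
    by blast
  obtain l j' w' where step: "load_sequence 1 (ls @ [l])" "j' \<le> n"
    "offline_bounds (ls @ [l]) w' (real j' / real n)"
    "c * ((w' - real j' / real n) - (w - real j / real n))
      + (potential \<epsilon> (online_state (ls @ [l])) (real j' / real n)
          - potential \<epsilon> (online_state ls) (real j / real n)) + \<epsilon> * \<delta> / 2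
      \<le> (1 + \<epsilon>) * (online_cost (ls @ [l]) - online_cost ls)"
    using adversary_step[OF run(1-3)] by metis
  have "real (Suc T) * (\<epsilon> * \<delta> / 2) = real T * (\<epsilon> * \<delta> / 2) + \<epsilon> * \<delta> / 2"
    by (simp add: algebra_simps add_divide_distrib)
  then have "c * (w' - 2 * s - real j' / real n)
      + potential \<epsilon> (online_state (ls @ [l])) (real j' / real n)
      + real (Suc T) * (\<epsilon> * \<delta> / 2) \<le> (1 + \<epsilon>) * online_cost (ls @ [l])"
    using run(4) step(4) unfolding right_diff_distrib by linarith
  with step(1-3) show ?case by blast
qed

lemma not_competitive:
  "\<exists>ls. load_sequence 1 ls \<and> c * offline_opt 1 2 f ls < (1 + \<epsilon>) * online_cost ls"
proof -
  have "0 < \<epsilon> * \<delta> / 2" using eps delta by simp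
  \<comment> \<open>The 10 covers 4 from the lower bound on the potential and 6 from c (2 s + j /
    n).\<close>
  then obtain T :: nat where T: "10 < real T * (\<epsilon> * \<delta> / 2)"
    using reals_Archimedean3 by blast
  obtain ls j w where run: "load_sequence 1 ls" "j \<le> n" "offline_bounds ls w (real j / real n)"
    "c * (w - 2 * s - real j / real n) + potential \<epsilon> (online_state ls) (real j / real n)
      + real T * (\<epsilon> * \<delta> / 2) \<le> (1 + \<epsilon>) * online_cost ls"
    using adversary_run[of T] by blast
  have u: "real j / real n \<le> 1" using run(2) n_ge by simp
  have "- 4 \<le> potential \<epsilon> (online_state ls) (real j / real n)"
    using eps u online_state_bounds[OF run(1)] by (intro potential_ge) auto
  moreover have "c * (2 * s + real j / real n) \<le> 2 * (2 * 1 + 1)"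
    using c_bounds s_bounds u by (intro mult_mono add_mono) auto
  moreover have "c * offline_opt 1 2 f ls \<le> c * w"
    using offline_opt_le_reachable[OF model run(1), of s w] run(3) c_bounds
    by (intro mult_left_mono) (auto simp: offline_bounds_def)
  ultimately have "c * offline_opt 1 2 f ls < (1 + \<epsilon>) * online_cost ls"
    using T run(4) by (simp add: algebra_simps)
  with run(1) show ?thesis by blast
qed

end

theorem theorem5p7:
  "\<not> (\<exists>(A :: online_alg) (c :: real). c < 2 \<and> online_algorithm A \<and> competitive_ratio A c)"
proof
  assume "\<exists>(A :: online_alg) (c :: real). c < 2 \<and> online_algorithm A \<and> competitive_ratio A c"
  then obtain A c0 where A: "online_algorithm A" "competitive_ratio A c0" and "c0 < 2" by blast
  \<comment> \<open>Raising the ratio to at least 1 makes it nonnegative and is harmless, since the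
    optimum is nonnegative.\<close>
  define c where "c = max c0 1"
  have c: "1 \<le> c" "c < 2" "c0 \<le> c" using \<open>c0 < 2\<close> by (auto simp: c_def)
  \<comment> \<open>For large \<open>n\<close> even (1 + \<epsilon>) c stays below 2; running the
    adversary with this ratio absorbs the factor 1 + \<epsilon> on the online cost.\<close>
  obtain n0 :: nat where n0: "2 * c < real n0 * (2 - c)"
    using reals_Archimedean3[of "2 - c"] c by auto
  define n where "n = max n0 2"
  have "real n0 * (2 - c) \<le> real n * (2 - c)"
    using c by (intro mult_right_mono) (auto simp: n_def)
  with n0 have "2 * c < real n * (2 - c)" by linarith
  moreover have "0 < real n" by (simp add: n_def)
  ultimately have "(1 + 2 / real n) * c < 2" by (simp add: field_simps)
  then interpret adversary A n "(1 + 2 / real n) * c"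
    using A c by unfold_locales (auto simp: n_def)
  obtain ls where ls: "load_sequence 1 ls"
    "(1 + \<epsilon>) * c * offline_opt 1 2 f ls < (1 + \<epsilon>) * online_cost ls"
    using not_competitive unfolding \<epsilon>_def[symmetric] by blast
  have "online_cost ls \<le> c0 * offline_opt 1 2 f ls"
    using A(2) model ls(1) unfolding competitive_ratio_def by blast
  also have "\<dots> \<le> c * offline_opt 1 2 f ls"
    using c offline_opt_nonneg[OF model ls(1)] by (intro mult_right_mono)
  finally have "(1 + \<epsilon>) * online_cost ls \<le> (1 + \<epsilon>) * (c * offline_opt 1 2 f ls)"
    using eps by (intro mult_left_mono) auto
  with ls(2) show False by (simp add: mult.assoc)
qed

end
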